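(* Let $G=(V,E)$ be a connected graph with $p$ vertices, and let $T_G(\mathbf{x})$ be its spanning-tree polynomial. Then $T_G^{-\beta}$ is completely monotone on $(0,\infty)^E$ for $\beta=0,\frac12,1,\frac32,\ldots$ and for all real $\beta\ge(p-2)/2$.
   Context: Graphs are finite and undirected, and may have loops and multiple edges. For a connected graph $G=(V,E)$, $T_G(\mathbf{x})=\sum_{T\in\mathcal{T}(G)}\prod_{e\in T}x_e$, where $\mathbf{x}=\{x_e\}_{e\in E}$ and $\mathcal{T}(G)$ is the family of edge sets of spanning trees of $G$. A $C^\infty$ function $f$ on $(0,\infty)^E$ is completely monotone if $(-1)^k\,\partial^kf/\partial x_{e_1}\cdots\partial x_{e_k}\ge 0$ everywhere on $(0,\infty)^E$ for all $k\ge 0$ and all $e_1,\ldots,e_k\in E$. *)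

theory Defs
  imports "HOL-Analysis.Analysis"
begin

text \<open>Undirected graphs with an edge set of their own, so that parallel edges are distinct; the
  set of ends of an edge has one element if the edge is a loop and two otherwise.\<close>

record ('v, 'e) graph =
  verts :: "'v set"
  edges :: "'e set"
  ends :: "'e \<Rightarrow> 'v set"

definition finite_graph :: "('v, 'e) graph \<Rightarrow> bool" where
  "finite_graph G \<longleftrightarrow> finite (verts G) \<and> finite (edges G) \<and>
     (\<forall>e\<in>edges G. ends G e \<subseteq> verts G \<and> card (ends G e) \<in> {1, 2})"

text \<open>A walk from \<open>u\<close> to \<open>w\<close> is the list of its steps, each step being the edge traversed
  together with the vertex it leads to.\<close>

fun walk :: "('v, 'e) graph \<Rightarrow> 'v \<Rightarrow> ('e \<times> 'v) list \<Rightarrow> 'v \<Rightarrow> bool" where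
  "walk G u [] w \<longleftrightarrow> u \<in> verts G \<and> u = w"
| "walk G u ((e, v) # s) w \<longleftrightarrow>
     u \<in> verts G \<and> e \<in> edges G \<and> ends G e = {u, v} \<and> walk G v s w"

definition connected_graph :: "('v, 'e) graph \<Rightarrow> bool" where
  "connected_graph G \<longleftrightarrow> verts G \<noteq> {} \<and> (\<forall>u\<in>verts G. \<forall>w\<in>verts G. \<exists>s. walk G u s w)"

text \<open>Since the edges are required to be distinct, a loop is a cycle of length 1, two parallel
  edges form a cycle of length 2, and going back and forth along one edge is not a cycle.\<close>

definition cycle :: "('v, 'e) graph \<Rightarrow> 'v \<Rightarrow> ('e \<times> 'v) list \<Rightarrow> bool" where
  "cycle G u s \<longleftrightarrow> s \<noteq> [] \<and> walk G u s u \<and> distinct (map fst s) \<and> distinct (map snd s)"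

definition tree :: "('v, 'e) graph \<Rightarrow> bool" where
  "tree G \<longleftrightarrow> connected_graph G \<and> \<not> (\<exists>u s. cycle G u s)"

definition spanning_trees :: "('v, 'e) graph \<Rightarrow> 'e set set" where
  "spanning_trees G = {T. T \<subseteq> edges G \<and> tree (G\<lparr>edges := T\<rparr>)}"

definition spanning_tree_poly :: "('v, 'e) graph \<Rightarrow> ('e \<Rightarrow> real) \<Rightarrow> real" where
  "spanning_tree_poly G x = (\<Sum>T\<in>spanning_trees G. \<Prod>e\<in>T. x e)"

text \<open>Points of \<open>(0,\<infinity>)\<^sup>E\<close> are functions on \<open>E\<close>, extended by \<open>undefined\<close> off \<open>E\<close>. For finite \<open>E\<close>
  the product topology on functions restricts to the usual topology of this orthant.\<close>

definition pos_orthant :: "'e set \<Rightarrow> ('e \<Rightarrow> real) set" where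
  "pos_orthant E = (\<Pi>\<^sub>E e\<in>E. {0<..})"

definition partial_deriv :: "'e \<Rightarrow> (('e \<Rightarrow> real) \<Rightarrow> real) \<Rightarrow> ('e \<Rightarrow> real) \<Rightarrow> real" where
  "partial_deriv e f x = deriv (\<lambda>t. f (x(e := t))) (x e)"

text \<open>For \<open>es = [e\<^sub>1, \<dots>, e\<^sub>k]\<close> this is the \<open>k\<close>-th order partial derivative of \<open>f\<close> with respect to
  \<open>x\<^bsub>e\<^sub>1\<^esub>, \<dots>, x\<^bsub>e\<^sub>k\<^esub>\<close>, the derivative in \<open>x\<^bsub>e\<^sub>k\<^esub>\<close> being taken first.\<close>

definition iter_partial_deriv ::
    "'e list \<Rightarrow> (('e \<Rightarrow> real) \<Rightarrow> real) \<Rightarrow> ('e \<Rightarrow> real) \<Rightarrow> real" where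
  "iter_partial_deriv es f = foldr partial_deriv es f"

text \<open>All partial derivatives of all orders exist and are continuous. Existence is required
  separately because \<open>deriv\<close> is total.\<close>

definition smooth_on_orthant :: "'e set \<Rightarrow> (('e \<Rightarrow> real) \<Rightarrow> real) \<Rightarrow> bool" where
  "smooth_on_orthant E f \<longleftrightarrow>
     (\<forall>es\<in>lists E. continuous_on (pos_orthant E) (iter_partial_deriv es f) \<and>
        (\<forall>e\<in>E. \<forall>x\<in>pos_orthant E.
           (\<lambda>t. iter_partial_deriv es f (x(e := t))) differentiable (at (x e))))"

definition completely_monotone :: "'e set \<Rightarrow> (('e \<Rightarrow> real) \<Rightarrow> real) \<Rightarrow> bool" where
  "completely_monotone E f \<longleftrightarrow> smooth_on_orthant E f \<and>
     (\<forall>es\<in>lists E. \<forall>x\<in>pos_orthant E. (- 1) ^ length es * iter_partial_deriv es f x \<ge> 0)"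

end

theory Submission
  imports Defs "HOL-Probability.Distributions"
begin

text \<open>By the matrix-tree theorem, \<open>T\<^sub>G\<close> is the determinant of the Laplacian with the row and column of
  a root deleted, that is, of a Gram matrix \<open>\<Sum>\<^sub>e x\<^sub>e a\<^sub>e a\<^sub>e\<^sup>T\<close> depending linearly on \<open>x\<close>. Determinants
  enter only as the product of the pivots \<open>p\<^sub>1 \<cdots> p\<^sub>n\<close> of Gaussian elimination. For the last pivot \<open>p\<close>
  and the product \<open>D\<close> of the others,
  \<open>(D p) powr -\<beta> = D powr -(\<beta> - 1/2) * 1/\<Gamma>(\<beta>) * \<integral> t powr (\<beta> - 1) * (D powr -1/2 * exp (-t p)) dt\<close>,
  where \<open>D powr -1/2 * exp (-t p)\<close> is a Gaussian integral of exponentials \<open>exp (-l x)\<close> with \<open>l\<close> linear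
  and nonnegative. Each step lowers \<open>\<beta>\<close> by \<open>1/2\<close> and the size by 1, so the induction succeeds if
  \<open>\<beta>\<close> reaches 0 or no pivot remains.

  Complete monotonicity is handled through finite differences instead of derivatives. Alternating
  differences pass to products, integrals and limits without any differentiation under the
  integral sign, and for a smooth function they imply the sign of the derivatives.\<close>

section \<open>Alternating differences\<close>

text \<open>The sign is opposite to the usual forward difference, so that complete monotonicity
  becomes nonnegativity of all iterated differences.\<close>

definition diff_op :: "('e \<Rightarrow> real) \<Rightarrow> (('e \<Rightarrow> real) \<Rightarrow> real) \<Rightarrow> ('e \<Rightarrow> real) \<Rightarrow> real" where
  "diff_op h f x = f x - f (\<lambda>i. x i + h i)"

text \<open>Vanishing off \<open>E\<close> preserves the value \<open>undefined\<close> there, so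
  that shifted points stay in \<open>pos_orthant E\<close>.\<close>

definition dirs :: "'e set \<Rightarrow> ('e \<Rightarrow> real) set" where
  "dirs E = {h. (\<forall>i. 0 \<le> h i) \<and> (\<forall>i. i \<notin> E \<longrightarrow> h i = 0)}"

definition alternating :: "'e set \<Rightarrow> (('e \<Rightarrow> real) \<Rightarrow> real) \<Rightarrow> bool" where
  "alternating E f \<longleftrightarrow> (\<forall>hs\<in>lists (dirs E). \<forall>x\<in>pos_orthant E. 0 \<le> foldr diff_op hs f x)"

lemma pos_orthant_add:
  assumes "x \<in> pos_orthant E" "h \<in> dirs E"
  shows "(\<lambda>i. x i + h i) \<in> pos_orthant E"
  using assms by (force simp: pos_orthant_def dirs_def PiE_iff extensional_def add_pos_nonneg)

lemma foldr_diff_op_cong: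
  assumes "hs \<in> lists (dirs E)" "x \<in> pos_orthant E" "\<And>x. x \<in> pos_orthant E \<Longrightarrow> f x = g x"
  shows "foldr diff_op hs f x = foldr diff_op hs g x"
  using assms(1,2)
proof (induction hs arbitrary: x)
  case (Cons h hs)
  then show ?case using pos_orthant_add[of x E h] by (simp add: diff_op_def)
qed (simp add: assms(3))

lemma alternating_cong:
  assumes "alternating E g" "\<And>x. x \<in> pos_orthant E \<Longrightarrow> f x = g x"
  shows "alternating E f"
  using assms(1) foldr_diff_op_cong[where f = f and g = g, OF _ _ assms(2)]
  by (simp add: alternating_def)

lemma alternating_nonneg: "alternating E f \<Longrightarrow> x \<in> pos_orthant E \<Longrightarrow> 0 \<le> f x"
  unfolding alternating_def by (drule bspec[of _ _ "[]"]) auto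

lemma alternating_diff_op:
  assumes "alternating E f" "h \<in> dirs E"
  shows "alternating E (diff_op h f)"
  unfolding alternating_def
proof (intro ballI)
  fix hs x assume "hs \<in> lists (dirs E)" "x \<in> pos_orthant E"
  then have "0 \<le> foldr diff_op (hs @ [h]) f x"
    using assms unfolding alternating_def by (metis Cons_in_lists_iff append_in_lists_conv lists.Nil)
  then show "0 \<le> foldr diff_op hs (diff_op h f) x" by simp
qed

lemma foldr_diff_op_shift:
  "foldr diff_op hs (\<lambda>x. f (\<lambda>i. x i + h i)) x = foldr diff_op hs f (\<lambda>i. x i + h i)"
  by (induction hs arbitrary: x) (simp_all add: diff_op_def add_ac)

lemma alternating_shift:
  assumes "alternating E f" "h \<in> dirs E"
  shows "alternating E (\<lambda>x. f (\<lambda>i. x i + h i))"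
  using assms(1) pos_orthant_add[OF _ assms(2)] by (simp add: alternating_def foldr_diff_op_shift)

section \<open>Closure properties of alternating functions, and the basic exponentials\<close>

lemma foldr_diff_op_add:
  "foldr diff_op hs (\<lambda>x. f x + g x) x = foldr diff_op hs f x + foldr diff_op hs g x"
  by (induction hs arbitrary: x) (simp_all add: diff_op_def)

lemma foldr_diff_op_cmult:
  "foldr diff_op hs (\<lambda>x. c * f x) x = c * foldr diff_op hs f x"
  by (induction hs arbitrary: x) (simp_all add: diff_op_def algebra_simps)

lemma alternating_cmult: "alternating E f \<Longrightarrow> 0 \<le> c \<Longrightarrow> alternating E (\<lambda>x. c * f x)"
  by (auto simp: alternating_def foldr_diff_op_cmult)

lemma alternating_const: "0 \<le> c \<Longrightarrow> alternating E (\<lambda>x. c)"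
proof -
  assume c: "0 \<le> c"
  have "foldr diff_op hs (\<lambda>x. c) x = (if hs = [] then c else 0)" for hs and x :: "'a \<Rightarrow> real"
    by (induction hs arbitrary: x) (auto simp: diff_op_def)
  then show ?thesis using c by (auto simp: alternating_def)
qed

text \<open>A discrete Leibniz rule: one difference of a product is a sum of two products whose
  factors are again alternating, with one difference fewer left to apply. Hence the induction varies
  \<open>f\<close> and \<open>g\<close>.\<close>

lemma alternating_mult:
  assumes "alternating E f" "alternating E g"
  shows "alternating E (\<lambda>x. f x * g x)"
  unfolding alternating_def
proof (rule ballI)
  fix hs assume "hs \<in> lists (dirs E)"
  then show "\<forall>x\<in>pos_orthant E. 0 \<le> foldr diff_op hs (\<lambda>x. f x * g x) x"
    using assms
  proof (induction hs arbitrary: f g rule: rev_induct)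
    case Nil
    then show ?case by (simp add: alternating_nonneg)
  next
    case (snoc h hs)
    then have h: "h \<in> dirs E" and hs: "hs \<in> lists (dirs E)" by auto
    have "diff_op h (\<lambda>x. f x * g x)
        = (\<lambda>x. diff_op h f x * g x + f (\<lambda>i. x i + h i) * diff_op h g x)"
      by (rule ext) (simp add: diff_op_def algebra_simps)
    then show ?case
      using snoc.IH[OF hs alternating_diff_op[OF snoc.prems(2) h] snoc.prems(3)]
        snoc.IH[OF hs alternating_shift[OF snoc.prems(2) h] alternating_diff_op[OF snoc.prems(3) h]]
      by (simp add: foldr_diff_op_add add_nonneg_nonneg)
  qed
qed

text \<open>An iterated difference is a finite linear combination of values at points of the
  orthant, so it commutes with the integral.\<close>

lemma alternating_has_integral:
  fixes g :: "('e \<Rightarrow> real) \<Rightarrow> real \<Rightarrow> real"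
  assumes "\<And>y. y \<in> S \<Longrightarrow> alternating E (\<lambda>x. g x y)"
    and "\<And>x. x \<in> pos_orthant E \<Longrightarrow> (g x has_integral f x) S"
  shows "alternating E f"
  unfolding alternating_def
proof (intro ballI)
  fix hs x assume hs: "hs \<in> lists (dirs E)" and x: "x \<in> pos_orthant E"
  have "((\<lambda>y. foldr diff_op hs (\<lambda>x. g x y) x) has_integral foldr diff_op hs f x) S"
    using hs x
  proof (induction hs arbitrary: x)
    case (Cons h hs)
    then show ?case
      using pos_orthant_add[of x E h] by (auto simp: diff_op_def intro!: has_integral_diff)
  qed (simp add: assms(2))
  then show "0 \<le> foldr diff_op hs f x"
    using assms(1) hs x by (auto simp: alternating_def intro: has_integral_nonneg)
qed

lemma alternating_tendsto:
  assumes "\<And>n. alternating E (g n)"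
    and "\<And>x. x \<in> pos_orthant E \<Longrightarrow> (\<lambda>n. g n x) \<longlonglongrightarrow> f x"
  shows "alternating E f"
  unfolding alternating_def
proof (intro ballI)
  fix hs x assume hs: "hs \<in> lists (dirs E)" and x: "x \<in> pos_orthant E"
  have "(\<lambda>n. foldr diff_op hs (g n) x) \<longlonglongrightarrow> foldr diff_op hs f x"
    using hs x
  proof (induction hs arbitrary: x)
    case (Cons h hs)
    then show ?case
      using pos_orthant_add[of x E h] by (auto simp: diff_op_def intro!: tendsto_diff)
  qed (simp add: assms(2))
  then show "0 \<le> foldr diff_op hs f x"
    using assms(1) hs x by (intro LIMSEQ_le_const) (auto simp: alternating_def)
qed

text \<open>A shift by \<open>h\<close> multiplies the exponential by a constant. Each difference
  therefore contributes a factor \<open>1 - exp (- (\<Sum>e\<in>E. h e * l e))\<close>, which is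
  nonnegative.\<close>

lemma alternating_exp_linear:
  assumes "\<And>e. e \<in> E \<Longrightarrow> 0 \<le> l e"
  shows "alternating E (\<lambda>x. exp (- (\<Sum>e\<in>E. x e * l e)))"
proof -
  have shift: "exp (- (\<Sum>e\<in>E. (x e + h e) * l e)) =
      exp (- (\<Sum>e\<in>E. x e * l e)) * exp (- (\<Sum>e\<in>E. h e * l e))" for x h
    by (simp add: distrib_right sum.distrib flip: exp_add)
  have *: "foldr diff_op hs (\<lambda>x. exp (- (\<Sum>e\<in>E. x e * l e))) x =
      (\<Prod>h\<leftarrow>hs. 1 - exp (- (\<Sum>e\<in>E. h e * l e))) * exp (- (\<Sum>e\<in>E. x e * l e))" for hs x
  proof (induction hs arbitrary: x)
    case (Cons h hs)
    have "foldr diff_op (h # hs) f x = foldr diff_op hs f x - foldr diff_op hs f (\<lambda>i. x i + h i)" for f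
      by (simp add: diff_op_def)
    then show ?case by (simp only: Cons.IH shift) (simp add: algebra_simps)
  qed simp
  have "0 \<le> (\<Prod>h\<leftarrow>hs. 1 - exp (- (\<Sum>e\<in>E. h e * l e)))" if "hs \<in> lists (dirs E)" for hs
    using that assms by (induction hs) (auto simp: dirs_def sum_nonneg)
  then show ?thesis by (auto simp: alternating_def *)
qed

section \<open>Smooth functions on the orthant\<close>

text \<open>A syntactic class large enough for powers of positive polynomials and closed under
  partial differentiation on the orthant, so that derivatives of all orders come by
  iteration.\<close>

inductive_set smooth_fns :: "'e set \<Rightarrow> (('e \<Rightarrow> real) \<Rightarrow> real) set" for E where
  const: "(\<lambda>x. c) \<in> smooth_fns E"
| proj: "e \<in> E \<Longrightarrow> (\<lambda>x. x e) \<in> smooth_fns E"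
| add: "f \<in> smooth_fns E \<Longrightarrow> g \<in> smooth_fns E \<Longrightarrow> (\<lambda>x. f x + g x) \<in> smooth_fns E"
| mult: "f \<in> smooth_fns E \<Longrightarrow> g \<in> smooth_fns E \<Longrightarrow> (\<lambda>x. f x * g x) \<in> smooth_fns E"
| powr: "f \<in> smooth_fns E \<Longrightarrow> (\<And>x. x \<in> pos_orthant E \<Longrightarrow> 0 < f x) \<Longrightarrow>
    (\<lambda>x. f x powr c) \<in> smooth_fns E"

lemma smooth_fns_sum:
  "(\<And>i. i \<in> I \<Longrightarrow> f i \<in> smooth_fns E) \<Longrightarrow> (\<lambda>x. \<Sum>i\<in>I. f i x) \<in> smooth_fns E"
  by (induction I rule: infinite_finite_induct) (auto intro: smooth_fns.intros)

lemma smooth_fns_prod: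
  "(\<And>i. i \<in> I \<Longrightarrow> f i \<in> smooth_fns E) \<Longrightarrow> (\<lambda>x. \<Prod>i\<in>I. f i x) \<in> smooth_fns E"
  by (induction I rule: infinite_finite_induct) (auto intro: smooth_fns.intros)

lemma smooth_fns_continuous_on:
  "f \<in> smooth_fns E \<Longrightarrow> continuous_on (pos_orthant E) f"
proof (induction rule: smooth_fns.induct)
  case (proj e)
  show ?case
    by (rule continuous_on_subset[of UNIV]) (auto intro: continuous_on_product_coordinates)
next
  case (powr f c)
  then show ?case by (auto intro!: continuous_on_powr continuous_on_const simp: less_imp_neq[symmetric])
qed (auto intro: continuous_intros)

lemma smooth_fns_deriv:
  assumes "f \<in> smooth_fns E" "e \<in> E"
  shows "\<exists>f'\<in>smooth_fns E. \<forall>x\<in>pos_orthant E.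
    ((\<lambda>t. f (x(e := t))) has_real_derivative f' x) (at (x e))"
  using assms
proof (induction rule: smooth_fns.induct)
  case (const c)
  show ?case by (rule bexI[of _ "\<lambda>x. 0"]) (auto intro: smooth_fns.const)
next
  case (proj d)
  show ?case
  proof (cases "d = e")
    case True
    then show ?thesis by (intro bexI[of _ "\<lambda>x. 1"]) (auto intro: smooth_fns.const)
  next
    case False
    then show ?thesis by (intro bexI[of _ "\<lambda>x. 0"]) (auto intro: smooth_fns.const)
  qed
next
  case (add f g)
  then obtain f' g' where "f' \<in> smooth_fns E" "g' \<in> smooth_fns E"
    "\<forall>x\<in>pos_orthant E. ((\<lambda>t. f (x(e := t))) has_real_derivative f' x) (at (x e))"
    "\<forall>x\<in>pos_orthant E. ((\<lambda>t. g (x(e := t))) has_real_derivative g' x) (at (x e))" by metis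
  then show ?case
    by (intro bexI[of _ "\<lambda>x. f' x + g' x"]) (auto simp del: fun_upd_apply intro: smooth_fns.add DERIV_add)
next
  case (mult f g)
  then obtain f' g' where "f' \<in> smooth_fns E" "g' \<in> smooth_fns E"
    "\<forall>x\<in>pos_orthant E. ((\<lambda>t. f (x(e := t))) has_real_derivative f' x) (at (x e))"
    "\<forall>x\<in>pos_orthant E. ((\<lambda>t. g (x(e := t))) has_real_derivative g' x) (at (x e))" by metis
  then show ?case
    using mult.hyps
    by (intro bexI[of _ "\<lambda>x. f' x * g x + g' x * f x"])
      (auto simp del: fun_upd_apply intro!: smooth_fns.add smooth_fns.mult DERIV_mult[THEN DERIV_cong])
next
  case (powr f c)
  then obtain f' where "f' \<in> smooth_fns E"
    "\<forall>x\<in>pos_orthant E. ((\<lambda>t. f (x(e := t))) has_real_derivative f' x) (at (x e))" by metis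
  then show ?case
    using powr.hyps
    by (intro bexI[of _ "\<lambda>x. c * f x powr (c - 1) * f' x"])
      (auto simp del: fun_upd_apply intro!: smooth_fns.mult smooth_fns.const smooth_fns.powr
        DERIV_fun_powr[THEN DERIV_cong])
qed

lemma pos_orthant_upd: "x \<in> pos_orthant E \<Longrightarrow> e \<in> E \<Longrightarrow> 0 < t \<Longrightarrow> x(e := t) \<in> pos_orthant E"
  by (auto simp: pos_orthant_def PiE_iff extensional_def)

text \<open>Changing one coordinate slightly does not leave the orthant. This matters because
  iterated derivatives are identified with members of \<open>smooth_fns\<close> only there.\<close>

lemma has_derivative_cong_orthant:
  assumes "x \<in> pos_orthant E" "e \<in> E" "\<And>x. x \<in> pos_orthant E \<Longrightarrow> f x = g x"
    "((\<lambda>t. g (x(e := t))) has_real_derivative D) (at (x e))"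
  shows "((\<lambda>t. f (x(e := t))) has_real_derivative D) (at (x e))"
proof -
  have "0 < x e" using assms(1,2) by (auto simp: pos_orthant_def PiE_iff)
  then have "\<forall>\<^sub>F t in nhds (x e). 0 < t" by (rule eventually_nhds_in_open[of "{0<..}", simplified, rotated]) simp
  then have "\<forall>\<^sub>F t in nhds (x e). f (x(e := t)) = g (x(e := t))"
    by eventually_elim (simp add: assms(1,2,3) pos_orthant_upd)
  then show ?thesis using assms(4) by (subst DERIV_cong_ev) auto
qed

text \<open>The negated derivative is a limit of difference quotients, that is, of nonnegative
  multiples of \<open>diff_op\<close> with step \<open>1 / (n + 1)\<close> in direction
  \<open>e\<close>.\<close>

lemma alternating_neg_deriv:
  assumes "alternating E f" "e \<in> E"
    "\<And>x. x \<in> pos_orthant E \<Longrightarrow> ((\<lambda>t. f (x(e := t))) has_real_derivative f' x) (at (x e))"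
  shows "alternating E (\<lambda>x. - f' x)"
proof (rule alternating_tendsto)
  let ?h = "\<lambda>n i. if i = e then inverse (real (Suc n)) else 0"
  show "alternating E (\<lambda>x. real (Suc n) * diff_op (?h n) f x)" for n
    by (rule alternating_cmult[OF alternating_diff_op[OF assms(1)]]) (auto simp: dirs_def assms(2))
  fix x assume x: "x \<in> pos_orthant E"
  have "((\<lambda>h. (f (x(e := x e + h)) - f x) / h) \<longlongrightarrow> f' x) (at 0)"
    using assms(3)[OF x] by (simp add: DERIV_def)
  moreover have "filterlim (\<lambda>n. inverse (real (Suc n))) (at 0) sequentially"
    by (intro filterlim_atI LIMSEQ_inverse_real_of_nat always_eventually) simp
  ultimately have "(\<lambda>n. (f (x(e := x e + inverse (real (Suc n)))) - f x) / inverse (real (Suc n)))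
      \<longlonglongrightarrow> f' x"
    by (rule filterlim_compose)
  from tendsto_minus[OF this]
  have "(\<lambda>n. real (Suc n) * (f x - f (x(e := x e + inverse (real (Suc n)))))) \<longlonglongrightarrow> - f' x"
    by (simp add: divide_inverse algebra_simps del: of_nat_Suc)
  moreover have "(\<lambda>i. x i + ?h n i) = x(e := x e + inverse (real (Suc n)))" for n
    by auto
  ultimately show "(\<lambda>n. real (Suc n) * diff_op (?h n) f x) \<longlonglongrightarrow> - f' x"
    by (simp only: diff_op_def)
qed

lemma completely_monotoneI:
  assumes "f \<in> smooth_fns E" "alternating E f"
  shows "completely_monotone E f"
proof -
  \<comment> \<open>Smoothness and sign are carried through the induction together: the next
    derivative exists by the first and is alternating after a sign change by the second.\<close>
  have *: "\<exists>g\<in>smooth_fns E. (\<forall>x\<in>pos_orthant E. iter_partial_deriv es f x = g x) \<and>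
      alternating E (\<lambda>x. (- 1) ^ length es * g x)" if "es \<in> lists E" for es
    using that
  proof (induction es)
    case Nil
    then show ?case using assms by (intro bexI[of _ f]) (auto simp: iter_partial_deriv_def)
  next
    case (Cons e es)
    then obtain g where g: "g \<in> smooth_fns E"
      "\<And>x. x \<in> pos_orthant E \<Longrightarrow> iter_partial_deriv es f x = g x"
      "alternating E (\<lambda>x. (- 1) ^ length es * g x)" and e: "e \<in> E" by auto
    obtain g' where g': "g' \<in> smooth_fns E"
      "\<And>x. x \<in> pos_orthant E \<Longrightarrow> ((\<lambda>t. g (x(e := t))) has_real_derivative g' x) (at (x e))"
      using smooth_fns_deriv[OF g(1) e] by blast
    have "alternating E (\<lambda>x. - ((- 1) ^ length es * g' x))"
      by (rule alternating_neg_deriv[OF g(3) e]) (auto intro: DERIV_cmult g')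
    moreover have "iter_partial_deriv (e # es) f x = g' x" if x: "x \<in> pos_orthant E" for x
      using DERIV_imp_deriv[OF has_derivative_cong_orthant[OF x e g(2) g'(2)[OF x]]]
      by (simp add: iter_partial_deriv_def partial_deriv_def del: fun_upd_apply)
    ultimately show ?case using g'(1) by auto
  qed
  have "smooth_on_orthant E f"
    unfolding smooth_on_orthant_def
  proof (intro ballI conjI)
    fix es assume "es \<in> lists E"
    then obtain g where g: "g \<in> smooth_fns E"
      "\<And>x. x \<in> pos_orthant E \<Longrightarrow> iter_partial_deriv es f x = g x" using * by blast
    show "continuous_on (pos_orthant E) (iter_partial_deriv es f)"
      using smooth_fns_continuous_on[OF g(1)] g(2) by (simp cong: continuous_on_cong)
    fix e x assume e: "e \<in> E" and x: "x \<in> pos_orthant E"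
    obtain g' where g': "g' \<in> smooth_fns E"
      "\<And>x. x \<in> pos_orthant E \<Longrightarrow> ((\<lambda>t. g (x(e := t))) has_real_derivative g' x) (at (x e))"
      using smooth_fns_deriv[OF g(1) e] by blast
    show "(\<lambda>t. iter_partial_deriv es f (x(e := t))) differentiable (at (x e))"
      using has_derivative_cong_orthant[OF x e g(2) g'(2)[OF x]]
      unfolding real_differentiable_def by blast
  qed
  moreover have "(- 1) ^ length es * iter_partial_deriv es f x \<ge> 0"
    if es: "es \<in> lists E" and x: "x \<in> pos_orthant E" for es x
  proof -
    obtain g where "iter_partial_deriv es f x = g x" "alternating E (\<lambda>x. (- 1) ^ length es * g x)"
      using *[OF es] x by blast
    then show ?thesis using alternating_nonneg[OF _ x] by simp
  qed
  ultimately show ?thesis by (simp add: completely_monotone_def)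
qed

section \<open>Gauss and Gamma integrals\<close>

lemma has_integral_gauss:
  fixes p c :: real
  assumes "0 < p"
  shows "((\<lambda>u. exp (- (p * (u + c)\<^sup>2))) has_integral sqrt (pi / p)) UNIV"
proof -
  \<comment> \<open>The standard deviation whose normal density has exponent
    \<open>- (p * (u + c)\<^sup>2)\<close>.\<close>
  let ?s = "1 / sqrt (2 * p)"
  have "(normal_density (- c) ?s has_integral 1) UNIV"
    using has_integral_integral_real[OF integrable_normal_density[of ?s "- c"]] assms by simp
  then have "((\<lambda>u. sqrt (pi / p) * normal_density (- c) ?s u) has_integral sqrt (pi / p) * 1) UNIV"
    by (rule has_integral_mult_right)
  moreover have "sqrt (pi / p) * normal_density (- c) ?s u = exp (- (p * (u + c)\<^sup>2))" for u
    using assms by (simp add: normal_density_def power_divide real_sqrt_divide)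
  ultimately show ?thesis by simp
qed

lemma has_integral_gamma:
  fixes p b :: real
  assumes "0 < p" "0 < b"
  shows "((\<lambda>t. t powr (b - 1) * exp (- (t * p))) has_integral Gamma b * p powr (- b)) {0..}"
proof -
  define F :: "real \<Rightarrow> real" where "F t = indicator {0..} t * (t powr (b - 1) / exp t)" for t
  have "has_bochner_integral lborel F (Gamma b)"
  proof (rule has_bochner_integral_nn_integral)
    show "F \<in> borel_measurable lborel" by (simp add: F_def[abs_def])
    show "(\<integral>\<^sup>+ x. ennreal (F x) \<partial>lborel) = ennreal (Gamma b)"
      using Gamma_conv_nn_integral_real[OF assms(2)] by (simp add: F_def)
  qed (use assms in \<open>auto simp: F_def Gamma_real_nonneg intro!: less_imp_le Gamma_real_pos\<close>)
  then have "has_bochner_integral lborel (\<lambda>t. F (0 + p * t)) (Gamma b /\<^sub>R \<bar>p\<bar>)"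
    using assms by (subst lborel_has_bochner_integral_real_affine_iff[symmetric]) auto
  then have "integrable lborel (\<lambda>t. F (p * t))" "(LBINT t. F (p * t)) = Gamma b / p"
    using assms by (simp_all add: has_bochner_integral_iff divide_inverse mult.commute)
  then have "((\<lambda>t. F (p * t)) has_integral Gamma b / p) UNIV"
    using has_integral_integral_lborel[of "\<lambda>t. F (p * t)"] by simp
  \<comment> \<open>This factor cancels the \<open>p powr (b - 1)\<close> that the substitution of
    \<open>p * t\<close> puts into the integrand.\<close>
  then have "((\<lambda>t. p powr (1 - b) * F (p * t)) has_integral p powr (1 - b) * (Gamma b / p)) UNIV"
    by (rule has_integral_mult_right)
  moreover have "p powr (1 - b) * F (p * t) =
      (if t \<in> {0..} then t powr (b - 1) * exp (- (t * p)) else 0)" for t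
  proof -
    have "p powr (1 - b) * p powr (b - 1) = 1" using assms by (simp flip: powr_add)
    then show ?thesis using assms
      by (auto simp: F_def indicator_def powr_mult zero_le_mult_iff exp_minus field_simps)
  qed
  moreover have "p powr (1 - b) * (Gamma b / p) = Gamma b * p powr (- b)"
    using assms by (simp add: powr_diff powr_minus field_simps)
  ultimately show ?thesis by (simp only: has_integral_restrict_UNIV)
qed

section \<open>Gaussian elimination\<close>

text \<open>The Schur complement of the entry \<open>(v, v)\<close>, kept on the full index type. At
  a zero pivot, division by zero gives 0 and the matrix is unchanged.\<close>

definition schur :: "'v \<Rightarrow> ('v \<Rightarrow> 'v \<Rightarrow> real) \<Rightarrow> 'v \<Rightarrow> 'v \<Rightarrow> real" where
  "schur v M i j = M i j - M i v * M v j / M v v"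

fun pivot_prod :: "'v list \<Rightarrow> ('v \<Rightarrow> 'v \<Rightarrow> real) \<Rightarrow> real" where
  "pivot_prod [] M = 1"
| "pivot_prod (v # vs) M = M v v * pivot_prod vs (schur v M)"

text \<open>Grounded Laplacians with nonnegative weights belong to this class. It is stable under
  elimination, and a zero pivot forces the rest of its row in \<open>S\<close> to vanish, which
  keeps degenerate pivots harmless.\<close>

definition diag_dominant :: "'v set \<Rightarrow> ('v \<Rightarrow> 'v \<Rightarrow> real) \<Rightarrow> bool" where
  "diag_dominant S M \<longleftrightarrow> (\<forall>i j. M i j = M j i) \<and> (\<forall>i j. i \<noteq> j \<longrightarrow> M i j \<le> 0) \<and>
     (\<forall>i\<in>S. 0 \<le> (\<Sum>j\<in>S. M i j))"

lemma diag_dominantD: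
  assumes "diag_dominant S M"
  shows "M i j = M j i" "i \<noteq> j \<Longrightarrow> M i j \<le> 0" "i \<in> S \<Longrightarrow> 0 \<le> (\<Sum>j\<in>S. M i j)"
  using assms unfolding diag_dominant_def by blast+

lemma diag_dominant_sum_nonpos:
  assumes "diag_dominant S M" "i \<notin> J"
  shows "(\<Sum>j\<in>J. M i j) \<le> 0"
  using assms by (intro sum_nonpos) (metis diag_dominantD(2))

lemma diag_dominant_subset:
  assumes "diag_dominant S M" "S' \<subseteq> S" "finite S"
  shows "diag_dominant S' M"
  unfolding diag_dominant_def
proof (intro conjI ballI allI impI)
  fix i assume i: "i \<in> S'"
  have "(\<Sum>j\<in>S. M i j) = (\<Sum>j\<in>S - S'. M i j) + (\<Sum>j\<in>S'. M i j)"
    by (rule sum.subset_diff) (use assms in auto)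
  moreover have "(\<Sum>j\<in>S - S'. M i j) \<le> 0"
    using diag_dominant_sum_nonpos[OF assms(1)] i by blast
  ultimately show "0 \<le> (\<Sum>j\<in>S'. M i j)"
    using diag_dominantD(3)[OF assms(1)] i assms(2) by fastforce
qed (use diag_dominantD[OF assms(1)] in auto)

lemma diag_dominant_diag_nonneg:
  assumes "diag_dominant (insert v S) M" "v \<notin> S" "finite S"
  shows "0 \<le> M v v"
  using diag_dominantD(3)[OF assms(1), of v] diag_dominant_sum_nonpos[OF assms(1,2)] assms by simp

text \<open>Nonpositive terms with a nonnegative sum are all zero.\<close>

lemma diag_dominant_diag_zero:
  assumes "diag_dominant (insert v S) M" "v \<notin> S" "finite S" "M v v = 0" "j \<in> S"
  shows "M v j = 0"
proof -
  have le: "M v j \<le> 0" if "j \<in> S" for j using that assms(1,2) by (metis diag_dominantD(2))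
  have "(\<Sum>j\<in>S. M v j) = 0"
    using diag_dominantD(3)[OF assms(1), of v] diag_dominant_sum_nonpos[OF assms(1,2)] assms by simp
  then have "(\<Sum>j\<in>S. - M v j) = 0" by (simp add: sum_negf)
  then show ?thesis using le assms(3,5) by (subst (asm) sum_nonneg_eq_0_iff) auto
qed

lemma schur_sym: "(\<And>i j. M i j = M j i) \<Longrightarrow> schur v M i j = schur v M j i"
  by (simp add: schur_def mult.commute)

lemma fold_schur_sym: "(\<And>i j. M i j = M j i) \<Longrightarrow> fold schur vs M i j = fold schur vs M j i"
proof (induction vs arbitrary: M)
  case (Cons v vs)
  have "schur v M i j = schur v M j i" for i j by (rule schur_sym) (rule Cons.prems)
  then have "fold schur vs (schur v M) i j = fold schur vs (schur v M) j i" by (rule Cons.IH)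
  then show ?case by simp
qed simp

text \<open>Elimination never lowers a row sum: row \<open>i\<close> receives a nonnegative multiple
  of row \<open>v\<close>, and the sum of row \<open>v\<close> is nonnegative.\<close>

lemma diag_dominant_schur:
  assumes dd: "diag_dominant (insert v S) M" and v: "v \<notin> S" "finite S"
  shows "diag_dominant S (schur v M)"
proof (cases "M v v = 0")
  case True
  then have "schur v M = M" by (simp add: schur_def fun_eq_iff)
  then show ?thesis using diag_dominant_subset[OF dd] v by auto
next
  case False
  then have pos: "0 < M v v" using diag_dominant_diag_nonneg[OF dd v] by simp
  show ?thesis
    unfolding diag_dominant_def
  proof (intro conjI allI ballI impI)
    show "schur v M i j = schur v M j i" for i j by (rule schur_sym) (rule diag_dominantD(1)[OF dd])
    show "schur v M i j \<le> 0" if "i \<noteq> j" for i j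
    \<comment> \<open>The sign condition ranges over all indices. In the eliminated row and column
      the entries have become 0.\<close>
    proof (cases "i = v \<or> j = v")
      case True
      then show ?thesis using pos by (auto simp: schur_def)
    next
      case False
      then have "M i v \<le> 0" "M v j \<le> 0" by (auto intro!: diag_dominantD(2)[OF dd])
      then have "0 \<le> M i v * M v j / M v v" using pos by (simp add: mult_nonpos_nonpos)
      then show ?thesis using diag_dominantD(2)[OF dd that] by (simp add: schur_def)
    qed
    fix i assume i: "i \<in> S"
    have row_i: "0 \<le> M i v + (\<Sum>j\<in>S. M i j)" and row_v: "0 \<le> M v v + (\<Sum>j\<in>S. M v j)"
      using diag_dominantD(3)[OF dd, of i] diag_dominantD(3)[OF dd, of v] i v by simp_all
    have "M i v \<le> 0" using i v by (intro diag_dominantD(2)[OF dd]) auto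
    then have "M i v * (M v v + (\<Sum>j\<in>S. M v j)) / M v v \<le> 0"
      using row_v pos by (simp add: divide_le_0_iff mult_nonpos_nonneg)
    then have "M i v * (\<Sum>j\<in>S. M v j) / M v v \<le> - M i v"
      using pos by (simp add: field_simps)
    then show "0 \<le> (\<Sum>j\<in>S. schur v M i j)"
      using row_i by (simp add: schur_def sum_subtractf sum_distrib_left sum_divide_distrib)
  qed
qed

lemma diag_dominant_add_diag:
  assumes "diag_dominant S M" "0 \<le> c" "finite S"
  shows "diag_dominant S (\<lambda>i j. M i j + (if i = u \<and> j = u then c else 0))"
  unfolding diag_dominant_def
proof (intro conjI allI ballI impI)
  fix i assume "i \<in> S"
  moreover have "0 \<le> (\<Sum>j\<in>S. if i = u \<and> j = u then c else 0)"
    using assms(2) by (intro sum_nonneg) auto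
  ultimately have "0 \<le> (\<Sum>j\<in>S. M i j) + (\<Sum>j\<in>S. if i = u \<and> j = u then c else 0)"
    using diag_dominantD(3)[OF assms(1)] by auto
  then show "0 \<le> (\<Sum>j\<in>S. M i j + (if i = u \<and> j = u then c else 0))"
    by (simp add: sum.distrib)
qed (use diag_dominantD[OF assms(1)] in auto)

lemma pivot_prod_nonneg: "diag_dominant (set vs) M \<Longrightarrow> distinct vs \<Longrightarrow> 0 \<le> pivot_prod vs M"
proof (induction vs arbitrary: M)
  case (Cons v vs)
  then have "diag_dominant (set vs) (schur v M)" "0 \<le> M v v"
    using diag_dominant_schur[of v "set vs" M] diag_dominant_diag_nonneg[of v "set vs" M] by auto
  then show ?case using Cons by simp
qed simp

section \<open>Reordering and perturbing pivots\<close>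

lemma pivot_prod_cong:
  "(\<And>i j. i \<in> set vs \<Longrightarrow> j \<in> set vs \<Longrightarrow> M i j = N i j) \<Longrightarrow> pivot_prod vs M = pivot_prod vs N"
proof (induction vs arbitrary: M N)
  case (Cons v vs)
  have "pivot_prod vs (schur v M) = pivot_prod vs (schur v N)"
    by (rule Cons.IH) (simp add: schur_def Cons.prems)
  then show ?case by (simp add: Cons.prems)
qed simp

lemma pivot_prod_snoc: "pivot_prod (vs @ [v]) M = pivot_prod vs M * fold schur vs M v v"
  by (induction vs arbitrary: M) simp_all

text \<open>Two eliminations amount to one with the 2 by 2 block on \<open>u\<close> and
  \<open>v\<close>, inverted by Cramer's rule. The resulting formula is symmetric in
  \<open>u\<close> and \<open>v\<close>.\<close>

lemma schur_schur:
  assumes "M v v \<noteq> 0" "M u v = M v u" "M u u * M v v \<noteq> M v u * M v u"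
  shows "schur u (schur v M) i j = M i j - (M i u * M u j * M v v + M i v * M v j * M u u
    - M i u * M v u * M v j - M i v * M v u * M u j) / (M u u * M v v - M v u * M v u)"
proof -
  have *: "m - p * q / a - (r - p * c / a) * (s - c * q / a) / (b - c * c / a) =
      m - (r * s * a + p * q * b - r * c * q - p * c * s) / (b * a - c * c)"
    if "a \<noteq> 0" "b * a \<noteq> c * c" for m p q r s a b c :: real
  proof -
    \<comment> \<open>Expressing \<open>b\<close> through the determinant \<open>d\<close> of the
      block leaves only \<open>a\<close> and \<open>d\<close> as denominators.\<close>
    define d where "d = b * a - c * c"
    have d: "d \<noteq> 0" "b = (d + c * c) / a" using that by (simp_all add: d_def)
    have "b - c * c / a = d / a" using that by (simp add: d_def field_simps)
    then show ?thesis using that d(1)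
      unfolding d_def[symmetric] by (simp add: d(2)) (simp add: field_simps)
  qed
  show ?thesis
    unfolding schur_def using *[OF assms(1,3)] assms(2) by simp
qed

lemma pivot_prod_swap:
  assumes dd: "diag_dominant (set (u # v # ws)) M" and dist: "distinct (u # v # ws)"
  shows "pivot_prod (u # v # ws) M = pivot_prod (v # u # ws) M"
proof -
  have sym: "M v u = M u v" using diag_dominantD(1)[OF dd] .
  have zero: "M u v = 0" if "M u u = 0 \<or> M v v = 0"
  proof -
    have "diag_dominant (insert u {v}) M" "diag_dominant (insert v {u}) M"
      by (rule diag_dominant_subset[OF dd]; simp)+
    then show ?thesis using that diag_dominant_diag_zero[of u "{v}" M v]
        diag_dominant_diag_zero[of v "{u}" M u] dist sym by auto
  qed
  show ?thesis
  \<comment> \<open>If a diagonal entry or the 2 by 2 determinant vanishes, both orders give product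
    0; otherwise both give the same first two factors and the same remaining matrix.\<close>
  proof (cases "M u u = 0 \<or> M v v = 0 \<or> M u u * M v v = M u v * M u v")
    case True
    then have "M u u * schur u M v v = 0" "M v v * schur v M u u = 0"
      using zero sym by (auto simp: schur_def field_simps)
    then show ?thesis by (auto simp flip: mult.assoc)
  next
    case False
    then have "schur v (schur u M) = schur u (schur v M)"
      using sym
      by (intro ext) (simp add: schur_schur[of M u v] schur_schur[of M v u] algebra_simps)
    moreover have "M u u * schur u M v v = M v v * schur v M u u"
      using False sym by (simp add: schur_def field_simps)
    ultimately show ?thesis by (simp add: mult.assoc[symmetric])
  qed
qed

text \<open>This is the determinant expansion along the entry \<open>(u, u)\<close>. Since \<open>u\<close> can be moved to the
  end of the elimination order, only the last pivot depends on that entry.\<close>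

lemma pivot_prod_add_diag:
  assumes "diag_dominant (set vs) M" "distinct vs" "u \<in> set vs" "0 \<le> c"
  shows "pivot_prod vs (\<lambda>i j. M i j + (if i = u \<and> j = u then c else 0)) =
    pivot_prod vs M + c * pivot_prod (remove1 u vs) M"
  using assms
proof (induction "length vs" arbitrary: vs M rule: less_induct)
  case less
  let ?A = "\<lambda>M i j. M i j + (if i = u \<and> j = u then c else 0)"
  have other: "pivot_prod (v # ws) (?A M) = pivot_prod (v # ws) M + c * pivot_prod (v # remove1 u ws) M"
    if "v \<noteq> u" "u \<in> set ws" "distinct (v # ws)" "diag_dominant (set (v # ws)) M"
      "length ws < length vs" for v ws
  proof -
    have "schur v (?A M) = ?A (schur v M)" using that(1) by (auto simp: schur_def fun_eq_iff)
    moreover have "pivot_prod ws (?A (schur v M)) =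
        pivot_prod ws (schur v M) + c * pivot_prod (remove1 u ws) (schur v M)"
      using that less.prems(4) by (intro less.hyps) (auto intro: diag_dominant_schur)
    ultimately show ?thesis using that(1) by (simp add: algebra_simps)
  qed
  obtain v ws where vs: "vs = v # ws" using less.prems(3) by (cases vs) auto
  show ?case
  proof (cases "v = u")
    case False
    then show ?thesis using other[of v ws] less.prems vs by auto
  next
    case True
    show ?thesis
    proof (cases ws)
      case Nil
      then show ?thesis using True vs by simp
    next
      case (Cons w ws')
      have dd': "diag_dominant (set vs) (?A M)"
        using less.prems by (intro diag_dominant_add_diag) auto
      \<comment> \<open>Putting \<open>w\<close> in front of \<open>u\<close> makes
        \<open>other\<close> applicable; the order is restored afterwards.\<close>
      have "pivot_prod vs (?A M) = pivot_prod (w # u # ws') (?A M)"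
        using dd' less.prems(2) unfolding vs Cons True by (rule pivot_prod_swap)
      also have "\<dots> = pivot_prod (w # u # ws') M + c * pivot_prod (w # remove1 u (u # ws')) M"
        using less.prems True vs Cons by (intro other) (auto simp: insert_commute)
      also have "pivot_prod (w # u # ws') M = pivot_prod vs M"
        using less.prems(1,2) unfolding vs Cons True by (rule pivot_prod_swap[symmetric])
      finally show ?thesis using True vs Cons by simp
    qed
  qed
qed

text \<open>Zero row sums survive each elimination with nonzero pivot, so the last pivot, a row of
  length one, is 0 unless an earlier one is.\<close>

lemma pivot_prod_zero_row_sums:
  assumes "\<And>i. i \<in> set vs \<Longrightarrow> (\<Sum>j\<in>set vs. M i j) = 0" "distinct vs" "vs \<noteq> []"
  shows "pivot_prod vs M = 0"
  using assms
proof (induction vs arbitrary: M)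
  case (Cons v vs)
  have row: "M i v + (\<Sum>j\<in>set vs. M i j) = 0" if "i \<in> set (v # vs)" for i
    using Cons.prems(1)[OF that] Cons.prems(2) by simp
  show ?case
  proof (cases "M v v = 0 \<or> vs = []")
    case True
    then show ?thesis using row[of v] by auto
  next
    case False
    have "(\<Sum>j\<in>set vs. schur v M i j) = 0" if "i \<in> set vs" for i
    proof -
      have "(\<Sum>j\<in>set vs. schur v M i j)
          = (\<Sum>j\<in>set vs. M i j) - M i v * (\<Sum>j\<in>set vs. M v j) / M v v"
        by (simp add: schur_def sum_subtractf sum_distrib_left sum_divide_distrib)
      also have "(\<Sum>j\<in>set vs. M i j) = - M i v" using row[of i] that by simp
      also have "(\<Sum>j\<in>set vs. M v j) = - M v v" using row[of v] by simp
      finally show ?thesis using False by simp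
    qed
    then have "pivot_prod vs (schur v M) = 0" using Cons False by auto
    then show ?thesis by simp
  qed
qed simp

section \<open>Negative powers of pivot products\<close>

definition qform :: "'v set \<Rightarrow> ('v \<Rightarrow> 'v \<Rightarrow> real) \<Rightarrow> ('v \<Rightarrow> real) \<Rightarrow> real" where
  "qform R M z = (\<Sum>i\<in>R. \<Sum>j\<in>R. z i * M i j * z j)"

lemma qform_cong: "(\<And>i. i \<in> R \<Longrightarrow> y i = z i) \<Longrightarrow> qform R M y = qform R M z"
  by (simp add: qform_def cong: sum.cong)

text \<open>Completing the square in the coordinate \<open>v\<close>.\<close>

lemma qform_insert:
  assumes "finite R" "v \<notin> R" "\<And>i j. M i j = M j i" "M v v \<noteq> 0"
  shows "qform (insert v R) M z =
    M v v * (z v + (\<Sum>j\<in>R. M v j * z j) / M v v)\<^sup>2 + qform R (schur v M) z"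
proof -
  define s where "s = (\<Sum>j\<in>R. M v j * z j)"
  have s1: "(\<Sum>j\<in>R. z v * M v j * z j) = z v * s"
    by (simp add: s_def sum_distrib_left mult.assoc)
  have s2: "(\<Sum>i\<in>R. z i * M i v * z v) = z v * s"
    unfolding s_def sum_distrib_left
  proof (rule sum.cong[OF refl])
    show "z i * M i v * z v = z v * (M v i * z i)" for i by (simp add: assms(3)[of i v])
  qed
  have "(\<Sum>i\<in>R. \<Sum>j\<in>R. z i * (M i v * M v j / M v v) * z j)
      = (\<Sum>i\<in>R. \<Sum>j\<in>R. (M v i * z i) * (M v j * z j)) / M v v"
    unfolding sum_divide_distrib
  proof (intro sum.cong refl)
    show "z i * (M i v * M v j / M v v) * z j = M v i * z i * (M v j * z j) / M v v" for i j
      by (simp add: assms(3)[of i v])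
  qed
  also have "\<dots> = s\<^sup>2 / M v v" by (simp add: s_def power2_eq_square sum_product)
  finally have s3: "(\<Sum>i\<in>R. \<Sum>j\<in>R. z i * (M i v * M v j / M v v) * z j) = s\<^sup>2 / M v v" .
  have "qform R M z = qform R (schur v M) z + s\<^sup>2 / M v v"
    by (simp add: qform_def schur_def s3[symmetric] algebra_simps sum_subtractf)
  moreover have "qform (insert v R) M z = z v * M v v * z v + z v * s + (z v * s + qform R M z)"
    using assms(1,2) by (simp add: qform_def sum.distrib s1 s2)
  ultimately show ?thesis
    unfolding s_def[symmetric] using assms(4) by (simp add: field_simps power2_eq_square)
qed

lemma pivots_pos_snoc:
  assumes "diag_dominant (set (vs @ [v])) M" "distinct (vs @ [v])" "0 < pivot_prod (vs @ [v]) M"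
  shows "diag_dominant (set vs) M" "0 < pivot_prod vs M" "0 < fold schur vs M v v"
proof -
  show dd: "diag_dominant (set vs) M" by (rule diag_dominant_subset[OF assms(1)]) auto
  have "0 \<le> pivot_prod vs M" by (rule pivot_prod_nonneg[OF dd]) (use assms(2) in simp)
  then show "0 < pivot_prod vs M" "0 < fold schur vs M v v"
    using assms(3) by (auto simp: pivot_prod_snoc zero_less_mult_iff)
qed

definition gram :: "'e set \<Rightarrow> ('e \<Rightarrow> 'v \<Rightarrow> real) \<Rightarrow> ('e \<Rightarrow> real) \<Rightarrow> 'v \<Rightarrow> 'v \<Rightarrow> real" where
  "gram E a x i j = (\<Sum>e\<in>E. x e * (a e i * a e j))"

lemma gram_sym: "gram E a x i j = gram E a x j i"
  by (simp add: gram_def mult.commute)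

text \<open>The form is linear in \<open>x\<close> with squares as coefficients, so
  \<open>alternating_exp_linear\<close> applies to its exponential.\<close>

lemma qform_gram: "qform R (gram E a x) z = (\<Sum>e\<in>E. x e * (\<Sum>i\<in>R. a e i * z i)\<^sup>2)"
proof -
  have "qform R (gram E a x) z = (\<Sum>i\<in>R. \<Sum>j\<in>R. \<Sum>e\<in>E. x e * ((a e i * z i) * (a e j * z j)))"
    by (simp add: qform_def gram_def sum_distrib_left sum_distrib_right mult_ac)
  also have "\<dots> = (\<Sum>e\<in>E. \<Sum>i\<in>R. \<Sum>j\<in>R. x e * ((a e i * z i) * (a e j * z j)))"
    by (simp only: sum.swap[of _ E R])
  finally show ?thesis by (simp only: power2_eq_square sum_product) (simp add: sum_distrib_left)
qed

text \<open>Integrating out the coordinate \<open>v\<close> of a Gaussian performs one elimination step.\<close>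

lemma alternating_gauss:
  assumes "distinct vs" "finite R" "R \<inter> set vs = {}"
    and "\<And>x. x \<in> pos_orthant E \<Longrightarrow> diag_dominant (set vs) (gram E a x)"
    and "\<And>x. x \<in> pos_orthant E \<Longrightarrow> 0 < pivot_prod vs (gram E a x)"
  shows "alternating E (\<lambda>x. pivot_prod vs (gram E a x) powr (- (1/2)) *
    exp (- qform R (fold schur vs (gram E a x)) z))"
  using assms
proof (induction vs arbitrary: R z rule: rev_induct)
  case Nil
  then show ?case using alternating_exp_linear[of E "\<lambda>e. (\<Sum>i\<in>R. a e i * z i)\<^sup>2"]
    by (simp add: qform_gram)
next
  case (snoc v vs)
  note pos = pivots_pos_snoc[OF snoc.prems(4,1,5)]
  define N where "N x = fold schur vs (gram E a x)" for x
  have v: "v \<notin> R" using snoc.prems(3) by auto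
  \<comment> \<open>The eliminated index \<open>v\<close> is moved into the Gaussian variables, and
    its coordinate \<open>u\<close> is the one to be integrated.\<close>
  have IH: "alternating E (\<lambda>x. pivot_prod vs (gram E a x) powr (- (1/2)) *
      exp (- qform (insert v R) (N x) (z(v := u))))" for u
    unfolding N_def using snoc.prems pos by (intro snoc.IH) auto
  have int: "((\<lambda>u. pivot_prod vs (gram E a x) powr (- (1/2)) *
        exp (- qform (insert v R) (N x) (z(v := u)))) has_integral
      sqrt pi * (pivot_prod (vs @ [v]) (gram E a x) powr (- (1/2)) *
        exp (- qform R (schur v (N x)) z))) UNIV"
    if x: "x \<in> pos_orthant E" for x
  proof -
    define p D Q c where "p = N x v v" and "D = pivot_prod vs (gram E a x)"
      and "Q = qform R (schur v (N x)) z" and "c = (\<Sum>j\<in>R. N x v j * z j) / p"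
    have p: "0 < p" "0 < D" using pos[OF x x] by (simp_all add: p_def D_def N_def)
    have "qform (insert v R) (N x) (z(v := u)) = p * (u + c)\<^sup>2 + Q" for u
    proof -
      have "(\<Sum>j\<in>R. N x v j * (z(v := u)) j) = (\<Sum>j\<in>R. N x v j * z j)"
        using v by (intro sum.cong) auto
      moreover have "qform R (schur v (N x)) (z(v := u)) = Q"
        unfolding Q_def using v by (intro qform_cong) auto
      ultimately show ?thesis
        using qform_insert[OF snoc.prems(2) v, of "N x" "z(v := u)"] p(1)
          fold_schur_sym[of "gram E a x", OF gram_sym]
        by (simp add: p_def c_def N_def del: fun_upd_apply) simp
    qed
    then have *: "D powr (- (1/2)) * exp (- qform (insert v R) (N x) (z(v := u))) =
        D powr (- (1/2)) * exp (- Q) * exp (- (p * (u + c)\<^sup>2))" for u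
      by (simp add: exp_add[symmetric])
    have "sqrt pi * ((D * p) powr (- (1/2)) * exp (- Q)) = D powr (- (1/2)) * exp (- Q) * sqrt (pi / p)"
      using p by (simp add: powr_mult powr_minus powr_half_sqrt real_sqrt_divide field_simps)
    moreover have "pivot_prod (vs @ [v]) (gram E a x) = D * p"
      by (simp add: pivot_prod_snoc D_def p_def N_def)
    ultimately show ?thesis
      unfolding D_def[symmetric] Q_def[symmetric] *
      by (simp only:) (intro has_integral_mult_right has_integral_gauss p)
  qed
  \<comment> \<open>The constant \<open>sqrt pi\<close> left by the Gaussian integral is divided
    out.\<close>
  have "alternating E (\<lambda>x. 1 / sqrt pi * (sqrt pi * (pivot_prod (vs @ [v]) (gram E a x) powr (- (1/2)) *
        exp (- qform R (schur v (N x)) z))))"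
    by (intro alternating_cmult alternating_has_integral[OF IH int]) auto
  then show ?case by (simp add: N_def)
qed

theorem alternating_pivot_prod_powr:
  assumes "distinct vs"
    and "\<And>x. x \<in> pos_orthant E \<Longrightarrow> diag_dominant (set vs) (gram E a x)"
    and "\<And>x. x \<in> pos_orthant E \<Longrightarrow> 0 < pivot_prod vs (gram E a x)"
    and "(\<exists>n::nat. \<beta> = real n / 2) \<or> \<beta> \<ge> (real (length vs) - 1) / 2"
  shows "alternating E (\<lambda>x. pivot_prod vs (gram E a x) powr (- \<beta>))"
  using assms
proof (induction vs arbitrary: \<beta> rule: rev_induct)
  \<comment> \<open>The empty product is 1, so the exponent is arbitrary here. The descent by 1/2
    may arrive at a negative \<beta>, down to -1/2.\<close>
  case Nil
  then show ?case by (simp add: alternating_const)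
next
  case (snoc v vs)
  note pos = pivots_pos_snoc[OF snoc.prems(2,1,3)]
  define N where "N x = fold schur vs (gram E a x)" for x
  have "0 \<le> \<beta>" using snoc.prems(4) by auto
  then consider "\<beta> = 0" | "0 < \<beta>" by linarith
  then show ?case
  proof cases
    case 1
    \<comment> \<open>Positivity of the product matters, since \<open>0 powr 0 = 0\<close>.\<close>
    show ?thesis
      by (rule alternating_cong[OF alternating_const[of 1]]) (use snoc.prems(3) 1 in force)+
  next
    case 2
    \<comment> \<open>Dropping one pivot lowers the threshold by exactly 1/2. In the half-integer
      case \<beta> > 0 ensures that \<open>n - 1\<close> is not truncated.\<close>
    have "(\<exists>n::nat. \<beta> - 1/2 = real n / 2) \<or> \<beta> - 1/2 \<ge> (real (length vs) - 1) / 2"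
      using snoc.prems(4)
    proof
      assume "\<exists>n::nat. \<beta> = real n / 2"
      then obtain n :: nat where n: "\<beta> = real n / 2" by auto
      then have "\<beta> - 1/2 = real (n - 1) / 2" using 2 by (simp add: of_nat_diff field_simps)
      then show ?thesis by blast
    qed (simp add: field_simps)
    then have IH: "alternating E (\<lambda>x. pivot_prod vs (gram E a x) powr (- (\<beta> - 1/2)))"
      using snoc.prems(1) pos by (intro snoc.IH) auto
    have g: "alternating E (\<lambda>x. t powr (\<beta> - 1) *
        (pivot_prod vs (gram E a x) powr (- (1/2)) * exp (- (t * N x v v))))" if t: "t \<in> {0..}" for t
    proof -
      \<comment> \<open>Evaluating the Gaussian at \<open>sqrt t\<close> in the single coordinate
        \<open>v\<close> produces the exponent \<open>t\<close> times the last pivot.\<close>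
      have "qform {v} (N x) (\<lambda>_. sqrt t) = t * N x v v" for x
        using t by (simp add: qform_def mult_ac)
      then show ?thesis
        using alternating_gauss[where E = E and a = a and vs = vs and R = "{v}" and z = "\<lambda>_. sqrt t"] snoc.prems(1) pos
        by (auto simp: N_def intro!: alternating_cmult)
    qed
    have int: "((\<lambda>t. t powr (\<beta> - 1) * (pivot_prod vs (gram E a x) powr (- (1/2)) * exp (- (t * N x v v))))
        has_integral pivot_prod vs (gram E a x) powr (- (1/2)) * (Gamma \<beta> * N x v v powr (- \<beta>))) {0..}"
      if x: "x \<in> pos_orthant E" for x
      using has_integral_mult_right[OF has_integral_gamma[OF pos(3)[OF x x] 2],
          of "pivot_prod vs (gram E a x) powr (- (1/2))"]
      by (simp add: N_def mult_ac)
    have "alternating E (\<lambda>x. 1 / Gamma \<beta> * (pivot_prod vs (gram E a x) powr (- (\<beta> - 1/2)) *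
        (pivot_prod vs (gram E a x) powr (- (1/2)) * (Gamma \<beta> * N x v v powr (- \<beta>)))))"
      using Gamma_real_pos[OF 2]
      by (intro alternating_cmult alternating_mult[OF IH] alternating_has_integral[OF g int]) auto
    then show ?thesis
    proof (rule alternating_cong)
      fix x assume x: "x \<in> pos_orthant E"
      have "pivot_prod vs (gram E a x) powr (- (\<beta> - 1/2)) * pivot_prod vs (gram E a x) powr (- (1/2))
          = pivot_prod vs (gram E a x) powr (- \<beta>)"
        by (simp flip: powr_add)
      then show "pivot_prod (vs @ [v]) (gram E a x) powr (- \<beta>) =
          1 / Gamma \<beta> * (pivot_prod vs (gram E a x) powr (- (\<beta> - 1/2)) *
          (pivot_prod vs (gram E a x) powr (- (1/2)) * (Gamma \<beta> * N x v v powr (- \<beta>))))"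
        using pos[OF x x] Gamma_real_pos[OF 2]
        by (simp add: pivot_prod_snoc N_def powr_mult)
    qed
  qed
qed

section \<open>Trees grown from a set of roots\<close>

text \<open>\<open>grow f R W T\<close>: starting from the vertices in \<open>R\<close>, adding the edges of \<open>T\<close> one by one,
  each leading to a new vertex, reaches exactly \<open>W\<close>. In other words, contracting \<open>R\<close> to one point
  turns \<open>T\<close> into a tree on \<open>W\<close>.\<close>

inductive grow :: "('e \<Rightarrow> 'v set) \<Rightarrow> 'v set \<Rightarrow> 'v set \<Rightarrow> 'e set \<Rightarrow> bool" for f R where
  base: "grow f R R {}"
| step: "grow f R W T \<Longrightarrow> w \<in> W \<Longrightarrow> v \<notin> W \<Longrightarrow> f e = {w, v} \<Longrightarrow> grow f R (insert v W) (insert e T)"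

lemma grow_roots: "grow f R W T \<Longrightarrow> R \<subseteq> W"
  by (induction rule: grow.induct) auto

lemma grow_ends: "grow f R W T \<Longrightarrow> e \<in> T \<Longrightarrow> f e \<subseteq> W \<and> \<not> f e \<subseteq> R"
  by (induction rule: grow.induct) (auto dest: grow_roots)

text \<open>The first edge added leads from a root to a vertex outside \<open>R\<close>.\<close>

lemma grow_no_crossing:
  "grow f R W T \<Longrightarrow> (T = {} \<and> W = R) \<or> (\<exists>e\<in>T. \<exists>r\<in>R. \<exists>v. v \<notin> R \<and> f e = {r, v})"
  by (induction rule: grow.induct) (auto dest: grow_roots)

lemma grow_insert_root:
  "grow f R W T \<Longrightarrow> v \<notin> W \<Longrightarrow> grow f (insert v R) (insert v W) T"
proof (induction rule: grow.induct)
  case (step W T w u e)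
  then have "grow f (insert v R) (insert u (insert v W)) (insert e T)"
    by (intro grow.step) auto
  then show ?case by (simp add: insert_commute)
qed (rule grow.base)

text \<open>Once \<open>v\<close> is a root, the step that added \<open>e\<close> can be skipped.
  That step can only have introduced \<open>v\<close>, because \<open>r\<close> was present from the
  start.\<close>

lemma grow_contract:
  "grow f R W T \<Longrightarrow> e \<in> T \<Longrightarrow> f e = {r, v} \<Longrightarrow> r \<in> R \<Longrightarrow> v \<notin> R \<Longrightarrow>
    grow f (insert v R) W (T - {e})"
proof (induction rule: grow.induct)
  case (step W T w u d)
  have RW: "R \<subseteq> W" using grow_roots[OF step.hyps(1)] .
  have dT: "d \<notin> T" using grow_ends[OF step.hyps(1)] step.hyps(3,4) by blast
  show ?case
  proof (cases "d = e")
    case True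
    then have "u = v" using step RW by (auto simp: doubleton_eq_iff)
    then show ?thesis using grow_insert_root[OF step.hyps(1,3)] True dT by simp
  next
    case False
    then have "grow f (insert v R) (insert u W) (insert d (T - {e}))"
      using step by (intro grow.step) auto
    then show ?thesis using False by (simp add: insert_Diff_if)
  qed
qed simp

text \<open>The converse of contraction: \<open>e\<close> is added first and reaches
  \<open>v\<close>; the given growth then continues.\<close>

lemma grow_expand:
  "grow f (insert v R) W T \<Longrightarrow> f e = {r, v} \<Longrightarrow> r \<in> R \<Longrightarrow> v \<notin> R \<Longrightarrow> grow f R W (insert e T)"
proof (induction rule: grow.induct)
  case base
  show ?case
    by (rule grow.step[where W = R and T = "{}" and w = r]) (use base grow.base in auto)
next
  case (step W T w u d)
  then have "grow f R (insert u W) (insert d (insert e T))"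
    by (intro grow.step) auto
  then show ?case by (simp add: insert_commute)
qed

section \<open>Deletion and contraction for the polynomial of grown trees\<close>

definition grow_poly :: "('e \<Rightarrow> 'v set) \<Rightarrow> 'v set \<Rightarrow> 'v set \<Rightarrow> 'e set \<Rightarrow> ('e \<Rightarrow> real) \<Rightarrow> real" where
  "grow_poly f V R E x = (\<Sum>T | T \<subseteq> E \<and> grow f R V T. \<Prod>e\<in>T. x e)"

text \<open>Trees avoiding \<open>e\<close> are those of the graph with \<open>e\<close> deleted.
  Removing \<open>e\<close> matches the others with the trees in which \<open>v\<close> is an
  additional root.\<close>

lemma grow_poly_insert:
  assumes "finite E" "e \<notin> E" "f e = {r, v}" "r \<in> R" "v \<notin> R"
  shows "grow_poly f V R (insert e E) x = grow_poly f V R E x + x e * grow_poly f V (insert v R) E x"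
proof -
  let ?A = "\<lambda>R E. {T. T \<subseteq> E \<and> grow f R V T}"
  have fin: "finite (?A R E)" for R by (rule finite_subset[of _ "Pow E"]) (use assms(1) in auto)
  have split: "?A R (insert e E) = ?A R E \<union> insert e ` ?A (insert v R) E"
  proof (intro set_eqI iffI)
    fix T assume T: "T \<in> ?A R (insert e E)"
    show "T \<in> ?A R E \<union> insert e ` ?A (insert v R) E"
    proof (cases "e \<in> T")
      case True
      then have "T - {e} \<in> ?A (insert v R) E" using T grow_contract[of f R V T e r v] assms by auto
      then have "insert e (T - {e}) \<in> insert e ` ?A (insert v R) E" by (rule imageI)
      then show ?thesis using True by (simp add: insert_absorb)
    qed (use T in auto)
  next
    fix T assume "T \<in> ?A R E \<union> insert e ` ?A (insert v R) E"
    then show "T \<in> ?A R (insert e E)"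
      using grow_expand[of f v R V _ e r] assms(3-5) by auto
  qed
  have inj: "inj_on (insert e) (?A (insert v R) E)"
  proof (rule inj_onI)
    fix S T assume "S \<in> ?A (insert v R) E" "T \<in> ?A (insert v R) E" "insert e S = insert e T"
    moreover from this have "e \<notin> S" "e \<notin> T" using assms(2) by auto
    ultimately show "S = T" by (simp add: insert_ident)
  qed
  have "grow_poly f V R (insert e E) x =
      grow_poly f V R E x + (\<Sum>T\<in>insert e ` ?A (insert v R) E. \<Prod>e\<in>T. x e)"
    unfolding grow_poly_def split
    by (rule sum.union_disjoint) (use fin assms(2) in auto)
  also have "(\<Sum>T\<in>insert e ` ?A (insert v R) E. \<Prod>e\<in>T. x e) =
      (\<Sum>T\<in>?A (insert v R) E. x e * (\<Prod>e\<in>T. x e))"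
    unfolding sum.reindex[OF inj] o_def
    by (intro sum.cong refl prod.insert) (use assms(1,2) in \<open>auto intro: finite_subset\<close>)
  finally show ?thesis by (simp add: grow_poly_def sum_distrib_left)
qed

lemma grow_poly_no_crossing:
  assumes "\<And>e r v. e \<in> E \<Longrightarrow> f e = {r, v} \<Longrightarrow> r \<in> R \<Longrightarrow> v \<in> R"
  shows "grow_poly f V R E x = (if V = R then 1 else 0)"
proof -
  have "T = {} \<and> V = R" if "T \<subseteq> E" "grow f R V T" for T
    using grow_no_crossing[OF that(2)] that(1) assms by blast
  then have "{T. T \<subseteq> E \<and> grow f R V T} = (if V = R then {{}} else {})"
    by (auto intro: grow.base)
  then show ?thesis by (simp add: grow_poly_def)
qed

text \<open>The matrix-tree theorem for the Laplacian grounded at \<open>R\<close>, by deletion and contraction of an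
  edge joining \<open>R\<close> to its complement. Contracting enlarges \<open>R\<close> by a vertex, which deletes the
  corresponding row and column.\<close>

theorem pivot_prod_laplacian:
  fixes s t :: "'e \<Rightarrow> 'v"
  defines "a \<equiv> \<lambda>e i. of_bool (i = s e) - of_bool (i = t e)"
  assumes "finite E" "R \<subseteq> V" "distinct vs" "set vs = V - R"
    and "\<And>e. e \<in> E \<Longrightarrow> s e \<in> V \<and> t e \<in> V" "\<And>e. e \<in> E \<Longrightarrow> 0 \<le> x e"
  shows "diag_dominant (set vs) (gram E a x)"
    and "pivot_prod vs (gram E a x) = grow_poly (\<lambda>e. {s e, t e}) V R E x"
proof -
  have gram: "gram E a x i j = (\<Sum>e\<in>E. x e * (a e i * a e j))" for E i j
    by (simp add: gram_def)
  \<comment> \<open>Only edges with exactly one end in \<open>vs\<close> contribute to a row sum,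
    and they do so with nonnegative weight when \<open>i\<close> lies in \<open>vs\<close>.\<close>
  have row: "(\<Sum>j\<in>set vs. gram E a x i j) =
      (\<Sum>e\<in>E. x e * (a e i * (of_bool (s e \<in> set vs) - of_bool (t e \<in> set vs))))"
    for E i and vs :: "'v list"
  proof -
    have "(\<Sum>j\<in>set vs. gram E a x i j) = (\<Sum>e\<in>E. x e * (a e i * (\<Sum>j\<in>set vs. a e j)))"
      unfolding gram sum_distrib_left by (rule sum.swap)
    moreover have "(\<Sum>j\<in>set vs. a e j) = of_bool (s e \<in> set vs) - of_bool (t e \<in> set vs)" for e
      by (simp add: a_def sum_subtractf of_bool_def)
    ultimately show ?thesis by simp
  qed
  have dd: "diag_dominant (set vs) (gram E a x)"
    if "\<And>e. e \<in> E \<Longrightarrow> 0 \<le> x e" for E and vs :: "'v list"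
    unfolding diag_dominant_def
  proof (intro conjI allI ballI impI)
    show "gram E a x i j = gram E a x j i" for i j
      by (rule gram_sym)
    show "gram E a x i j \<le> 0" if "i \<noteq> j" for i j
    proof -
      have "a e i * a e j \<le> 0" for e using that by (auto simp: a_def)
      then show ?thesis
        unfolding gram using \<open>\<And>e. e \<in> E \<Longrightarrow> 0 \<le> x e\<close> by (simp add: sum_nonpos mult_nonneg_nonpos)
    qed
    show "0 \<le> (\<Sum>j\<in>set vs. gram E a x i j)" if "i \<in> set vs" for i
    proof -
      have "0 \<le> a e i * (of_bool (s e \<in> set vs) - of_bool (t e \<in> set vs))" for e
        using that by (auto simp: a_def)
      then show ?thesis
        unfolding row using \<open>\<And>e. e \<in> E \<Longrightarrow> 0 \<le> x e\<close> by (simp add: sum_nonneg)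
    qed
  qed
  show "diag_dominant (set vs) (gram E a x)" by (rule dd) (rule assms)
  show "pivot_prod vs (gram E a x) = grow_poly (\<lambda>e. {s e, t e}) V R E x"
    using assms(2-)
  proof (induction "card E" arbitrary: E R vs rule: less_induct)
    case less
    show ?case
    proof (cases "\<exists>e\<in>E. \<exists>r v. {s e, t e} = {r, v} \<and> r \<in> R \<and> v \<notin> R")
      case True
      then obtain e r v where e: "e \<in> E" "{s e, t e} = {r, v}" "r \<in> R" "v \<notin> R" by blast
      define E' where "E' = E - {e}"
      have E: "E = insert e E'" "e \<notin> E'" "finite E'" using e(1) less.prems(1) by (auto simp: E'_def)
      have card: "card E' < card E" using E by simp
      have v: "v \<in> set vs" using e less.prems(4,5) by (auto simp: doubleton_eq_iff)
      have r: "r \<notin> set vs" using e less.prems(4) by auto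
      have "pivot_prod vs (gram E a x) = pivot_prod vs
          (\<lambda>i j. gram E' a x i j + (if i = v \<and> j = v then x e else 0))"
      proof (rule pivot_prod_cong)
        fix i j assume "i \<in> set vs" "j \<in> set vs"
        \<comment> \<open>The end \<open>r\<close> is grounded, so \<open>e\<close> is visible only
          in the diagonal entry of \<open>v\<close>.\<close>
        then have "a e i * a e j = (if i = v \<and> j = v then 1 else 0)"
          using e r by (auto simp: a_def doubleton_eq_iff)
        then show "gram E a x i j =
            gram E' a x i j + (if i = v \<and> j = v then x e else 0)"
          using E by (simp add: gram)
      qed
      also have "\<dots> = pivot_prod vs (gram E' a x) +
          x e * pivot_prod (remove1 v vs) (gram E' a x)"
        using less.prems E v by (intro pivot_prod_add_diag dd) auto
      also have "pivot_prod vs (gram E' a x) = grow_poly (\<lambda>e. {s e, t e}) V R E' x"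
        using less.prems E card by (intro less.hyps) auto
      also have "pivot_prod (remove1 v vs) (gram E' a x) =
          grow_poly (\<lambda>e. {s e, t e}) V (insert v R) E' x"
        using less.prems E card v by (intro less.hyps) auto
      also have "grow_poly (\<lambda>e. {s e, t e}) V R E' x + x e * \<dots> = grow_poly (\<lambda>e. {s e, t e}) V R E x"
        unfolding E(1) using E e by (intro grow_poly_insert[symmetric]) auto
      finally show ?thesis .
    next
      case False
      then have cross: "s e \<in> R \<longleftrightarrow> t e \<in> R" if "e \<in> E" for e
        using that by (metis insert_commute)
      have poly: "grow_poly (\<lambda>e. {s e, t e}) V R E x = (if V = R then 1 else 0)"
        using False by (intro grow_poly_no_crossing) blast
      show ?thesis
      proof (cases "vs = []")
        case True
        then show ?thesis using poly less.prems(2,4) by auto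
      next
        case nonempty: False
        \<comment> \<open>No edge joins the remaining vertices to \<open>R\<close>, so the matrix is
          an ungrounded Laplacian; correspondingly no tree reaches them.\<close>
        have "pivot_prod vs (gram E a x) = 0"
        proof (rule pivot_prod_zero_row_sums[OF _ less.prems(3) nonempty])
          have "s e \<in> set vs \<longleftrightarrow> t e \<in> set vs" if "e \<in> E" for e
            using cross[OF that] less.prems(4,5) that by auto
          then show "(\<Sum>j\<in>set vs. gram E a x i j) = 0" for i
            unfolding row by (intro sum.neutral) auto
        qed
        then show ?thesis using poly nonempty less.prems(4) by auto
      qed
    qed
  qed
qed

section \<open>Spanning trees\<close>

lemma walk_append: "walk G u s v \<Longrightarrow> walk G v s' w \<Longrightarrow> walk G u (s @ s') w"
  by (induction G u s v rule: walk.induct) auto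

lemma walk_appendD: "walk G u (s @ (e, v) # s') w \<Longrightarrow>
    \<exists>y. walk G u s y \<and> e \<in> edges G \<and> ends G e = {y, v} \<and> walk G v s' w"
  by (induction s arbitrary: u) auto

lemma walk_verts: "walk G u s w \<Longrightarrow> u \<in> verts G \<and> w \<in> verts G"
  by (induction G u s w rule: walk.induct) auto

lemma walk_edges: "walk G u s w \<Longrightarrow> fst ` set s \<subseteq> edges G"
  by (induction G u s w rule: walk.induct) auto

lemma walk_mono:
  assumes "walk G u s w" "verts G \<subseteq> verts H" "edges G \<subseteq> edges H" "ends G = ends H"
  shows "walk H u s w"
  using assms(1) by (induction s arbitrary: u) (use assms(2-) in auto)

text \<open>For a nonempty walk the ends of its edges already place every vertex in
  \<open>W\<close>; an empty one could sit at a vertex outside.\<close>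

lemma walk_restrict:
  assumes "walk G u s w" "fst ` set s \<subseteq> T" "\<And>e. e \<in> T \<Longrightarrow> ends G e \<subseteq> W" "s \<noteq> []"
  shows "walk (G\<lparr>verts := W, edges := T\<rparr>) u s w"
  using assms(1,2,4)
proof (induction s arbitrary: u)
  case (Cons p s)
  obtain e v where p: "p = (e, v)" by (cases p)
  have e: "e \<in> T" "ends G e = {u, v}" "walk G v s w"
    using Cons.prems by (auto simp: p)
  have uv: "u \<in> W" "v \<in> W" using assms(3)[OF e(1)] e(2) by auto
  show ?case
  proof (cases "s = []")
    case False
    then show ?thesis using Cons e uv by (auto simp: p)
  qed (use e uv in \<open>auto simp: p\<close>)
qed simp

lemma walk_crossing:
  assumes "walk G u s y" "u \<in> W" "y \<notin> W"
  shows "\<exists>e\<in>edges G. \<exists>w\<in>W. \<exists>v\<in>verts G - W. ends G e = {w, v}"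
  using assms
proof (induction s arbitrary: u)
  case (Cons p s)
  obtain e v where p: "p = (e, v)" by (cases p)
  show ?case
  proof (cases "v \<in> W")
    case True
    then show ?thesis using Cons p by auto
  next
    case False
    then show ?thesis using Cons.prems walk_verts[of G v s y] p by auto
  qed
qed simp

text \<open>If the shortened tail returns to \<open>u\<close>, everything before that return is cut
  off.\<close>

lemma walk_distinct:
  assumes "walk G u s w"
  shows "\<exists>s'. walk G u s' w \<and> distinct (u # map snd s')"
  using assms
proof (induction s arbitrary: u)
  case Nil
  then show ?case by (intro exI[of _ "[]"]) auto
next
  case (Cons p s)
  obtain e v where p: "p = (e, v)" by (cases p)
  obtain s' where s': "walk G v s' w" "distinct (v # map snd s')" using Cons.IH[of v] Cons.prems p by auto
  show ?case
  proof (cases "u \<in> set (v # map snd s')")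
    case False
    then show ?thesis using Cons.prems s' p by (intro exI[of _ "(e, v) # s'"]) auto
  next
    case True
    show ?thesis
    proof (cases "u = v")
      case False
      then obtain e' where "(e', u) \<in> set s'" using True by auto
      then obtain s1 s2 where "s' = s1 @ (e', u) # s2" by (auto dest: split_list)
      then show ?thesis using s' walk_appendD[of G v s1 e' u s2 w] by (intro exI[of _ s2]) auto
    qed (use s' in auto)
  qed
qed

lemma walk_ends_subset:
  "walk G u s w \<Longrightarrow> e \<in> fst ` set s \<Longrightarrow> ends G e \<subseteq> insert u (snd ` set s)"
  by (induction G u s w rule: walk.induct) auto

text \<open>Using the first edge again would mean visiting its end \<open>u\<close> again.\<close>

lemma walk_distinct_edges:
  "walk G u s w \<Longrightarrow> distinct (u # map snd s) \<Longrightarrow> distinct (map fst s)"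
proof (induction s arbitrary: u)
  case (Cons p s)
  obtain e v where p: "p = (e, v)" by (cases p)
  have "e \<notin> fst ` set s"
    using walk_ends_subset[of G v s w e] Cons.prems by (auto simp: p)
  then show ?case using Cons by (auto simp: p)
qed simp

text \<open>A largest set that can be grown is everything: otherwise a walk to a missing vertex
  contains an edge leaving the set, which could be added.\<close>

lemma connected_grow:
  assumes "finite_graph G" "connected_graph G" "r \<in> verts G"
  shows "\<exists>T\<subseteq>edges G. grow (ends G) {r} (verts G) T"
proof -
  define P where "P W \<longleftrightarrow> W \<subseteq> verts G \<and> (\<exists>T\<subseteq>edges G. grow (ends G) {r} W T)" for W
  have fin: "finite (verts G)" using assms(1) by (simp add: finite_graph_def)
  have "P {r}" using assms(3) grow.base[of "ends G" "{r}"] by (auto simp: P_def)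
  moreover have "\<forall>W. P W \<longrightarrow> card W < Suc (card (verts G))"
    using fin by (auto simp: P_def less_Suc_eq_le intro: card_mono)
  ultimately obtain W where W: "P W" "\<And>W'. P W' \<Longrightarrow> card W' \<le> card W"
    using ex_has_greatest_nat[of P "{r}" card] by blast
  then obtain T where T: "T \<subseteq> edges G" "grow (ends G) {r} W T" "W \<subseteq> verts G" by (auto simp: P_def)
  have "W = verts G"
  proof (rule ccontr)
    assume "W \<noteq> verts G"
    then obtain y where y: "y \<in> verts G" "y \<notin> W" using T(3) by auto
    obtain s where "walk G r s y" using assms(2,3) y by (auto simp: connected_graph_def)
    then obtain e w v where e: "e \<in> edges G" "w \<in> W" "v \<in> verts G - W" "ends G e = {w, v}"
      using walk_crossing[of G r s y W] grow_roots[OF T(2)] y by blast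
    then have "grow (ends G) {r} (insert v W) (insert e T)"
      using T(2) by (intro grow.step) auto
    then have "P (insert v W)" using e T by (auto simp: P_def intro!: exI[of _ "insert e T"])
    moreover have "finite W" using T(3) fin finite_subset by blast
    ultimately show False using W(2)[of "insert v W"] e(3) by simp
  qed
  then show ?thesis using T by auto
qed

text \<open>At \<open>v\<close> the only edge is \<open>e\<close>, which a cycle uses at most once.
  Such a cycle could neither leave \<open>v\<close> after arriving by \<open>e\<close> nor reach
  \<open>v\<close> before departing by \<open>e\<close>.\<close>

lemma leaf_not_on_cycle:
  assumes "cycle G u s" "e \<in> edges G" "ends G e = {w, v}" "w \<noteq> v"
    and leaf: "\<And>d. d \<in> edges G \<Longrightarrow> d \<noteq> e \<Longrightarrow> v \<notin> ends G d"
  shows "e \<notin> fst ` set s"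
proof
  assume "e \<in> fst ` set s"
  then obtain y where "(e, y) \<in> set s" by auto
  then obtain s1 s2 where s: "s = s1 @ (e, y) # s2" by (auto dest: split_list)
  obtain z where z: "walk G u s1 z" "ends G e = {z, y}" "walk G y s2 u"
    using walk_appendD[of G u s1 e y s2 u] assms(1) by (auto simp: cycle_def s)
  have dist: "e \<notin> fst ` set s1" "e \<notin> fst ` set s2"
    using assms(1) by (auto simp: cycle_def s)
  have start: "s' = []" if "walk G v s' b" "e \<notin> fst ` set s'" for s' b
  proof (rule ccontr)
    assume "s' \<noteq> []"
    then obtain d c s'' where "s' = (d, c) # s''" by (cases s') auto
    then show False using that leaf[of d] by auto
  qed
  have stop: "s' = []" if "walk G b s' v" "e \<notin> fst ` set s'" for s' b
  proof (rule ccontr)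
    assume "s' \<noteq> []"
    then obtain d c s'' where s'': "s' = s'' @ [(d, c)]" by (cases s' rule: rev_cases) auto
    then show False using walk_appendD[of G b s'' d c "[]" v] that leaf[of d] by auto
  qed
  consider "z = w" "y = v" | "z = v" "y = w" using z(2) assms(3) by (auto simp: doubleton_eq_iff)
  then show False
  proof cases
    case 1
    then have "s2 = []" using start z(3) dist by blast
    then have "u = v" using z(3) 1 by simp
    then have "s1 = []" using start z(1) dist by blast
    then show False using z(1) 1 \<open>u = v\<close> assms(4) by simp
  next
    case 2
    then have "s1 = []" using stop z(1) dist by blast
    then have "u = v" using z(1) 2 by simp
    then have "s2 = []" using stop z(3) dist by blast
    then show False using z(3) 2 \<open>u = v\<close> assms(4) by simp
  qed
qed

text \<open>Every step attaches a leaf, which preserves connectedness and lies on no cycle; a cycle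
  would therefore already exist before the step.\<close>

lemma grow_tree:
  assumes "grow (ends G) {r} W T"
  shows "tree (G\<lparr>verts := W, edges := T\<rparr>)"
  using assms
proof (induction rule: grow.induct)
  case base
  have "walk (G\<lparr>verts := {r}, edges := {}\<rparr>) r [] r" by simp
  moreover have "\<not> cycle (G\<lparr>verts := {r}, edges := {}\<rparr>) u s" for u s
    using walk_edges[of "G\<lparr>verts := {r}, edges := {}\<rparr>" u s u] by (auto simp: cycle_def)
  ultimately show ?case by (auto simp: tree_def connected_graph_def intro: exI[of _ "[]"])
next
  case (step W T w v e)
  let ?G = "G\<lparr>verts := W, edges := T\<rparr>" and ?H = "G\<lparr>verts := insert v W, edges := insert e T\<rparr>"
  have ends: "\<And>d. d \<in> T \<Longrightarrow> ends G d \<subseteq> W" using grow_ends[OF step.hyps(1)] by blast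
  have new: "walk ?H w [(e, v)] v" "walk ?H v [(e, w)] w"
    using step.hyps by (auto simp: insert_commute)
  have old: "\<exists>s. walk ?H a s b" if "a \<in> W" "b \<in> W" for a b
    using step.IH that walk_mono[of ?G a _ b ?H]
    by (fastforce simp: tree_def connected_graph_def)
  have "\<exists>s. walk ?H a s b" if ab: "a \<in> insert v W" "b \<in> insert v W" for a b
  proof -
    have to_w: "\<exists>s. walk ?H a s w" if "a \<in> insert v W" for a
      using that old[of a w] new step.hyps(2) by blast
    have from_w: "\<exists>s. walk ?H w s b" if "b \<in> insert v W" for b
      using that old[of w b] new step.hyps(2) by blast
    obtain s s' where "walk ?H a s w" "walk ?H w s' b" using to_w[OF ab(1)] from_w[OF ab(2)] by auto
    from walk_append[OF this] show ?thesis by (rule exI)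
  qed
  then have "connected_graph ?H" by (simp add: connected_graph_def)
  moreover have "\<not> cycle ?H u s" for u s
  proof
    assume cyc: "cycle ?H u s"
    have "e \<notin> fst ` set s"
    proof (rule leaf_not_on_cycle[OF cyc])
      show "e \<in> edges ?H" "ends ?H e = {w, v}" "w \<noteq> v" using step.hyps by auto
      show "v \<notin> ends ?H d" if "d \<in> edges ?H" "d \<noteq> e" for d
        using that ends[of d] step.hyps(3) by auto
    qed
    then have "fst ` set s \<subseteq> T"
      using walk_edges[of ?H u s u] cyc by (auto simp: cycle_def)
    then have "walk (?H\<lparr>verts := W, edges := T\<rparr>) u s u"
      using walk_restrict[of ?H u s u T W] cyc ends by (simp add: cycle_def)
    then have "cycle ?G u s" using cyc by (simp add: cycle_def)
    then show False using step.IH by (auto simp: tree_def)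
  qed
  ultimately show ?case by (simp add: tree_def)
qed

text \<open>A spanning tree contains a grown tree on all vertices. A further edge would close a
  cycle with the path in that tree between its ends.\<close>

lemma spanning_trees_eq_grow:
  assumes "finite_graph G" "r \<in> verts G"
  shows "spanning_trees G = {T. T \<subseteq> edges G \<and> grow (ends G) {r} (verts G) T}"
proof (intro set_eqI iffI)
  fix T assume "T \<in> {T. T \<subseteq> edges G \<and> grow (ends G) {r} (verts G) T}"
  then show "T \<in> spanning_trees G"
    using grow_tree[of G r "verts G" T] by (auto simp: spanning_trees_def)
next
  fix T assume "T \<in> spanning_trees G"
  then have T: "T \<subseteq> edges G" "tree (G\<lparr>edges := T\<rparr>)" by (auto simp: spanning_trees_def)
  have "finite_graph (G\<lparr>edges := T\<rparr>)"
    using assms(1) T(1) by (auto simp: finite_graph_def intro: finite_subset)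
  then obtain T' where T': "T' \<subseteq> T" "grow (ends G) {r} (verts G) T'"
    using connected_grow[of "G\<lparr>edges := T\<rparr>" r] T(2) assms(2) by (auto simp: tree_def)
  have "T' = T"
  proof (rule ccontr)
    assume "T' \<noteq> T"
    then obtain e where e: "e \<in> T" "e \<notin> T'" using T'(1) by auto
    then have "ends G e \<subseteq> verts G" "card (ends G e) \<in> {1, 2}"
      using assms(1) T(1) by (auto simp: finite_graph_def)
    then obtain a b where ab: "ends G e = {a, b}" "a \<in> verts G" "b \<in> verts G"
      by (auto simp: card_1_singleton_iff card_2_iff)
    let ?G' = "G\<lparr>verts := verts G, edges := T'\<rparr>" and ?G = "G\<lparr>edges := T\<rparr>"
    have "connected_graph ?G'" using grow_tree[OF T'(2)] by (simp add: tree_def)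
    then obtain s where s: "walk ?G' b s a" "distinct (b # map snd s)"
      using ab walk_distinct[of ?G' b _ a] by (fastforce simp: connected_graph_def)
    have "walk ?G b s a" using walk_mono[OF s(1), of ?G] T'(1) by simp
    then have "walk ?G a ((e, b) # s) a" using ab e by auto
    moreover have "e \<notin> fst ` set s" using walk_edges[OF s(1)] e(2) by auto
    ultimately have "cycle ?G a ((e, b) # s)"
      using s(2) walk_distinct_edges[OF s] by (simp add: cycle_def)
    then show False using T(2) by (auto simp: tree_def)
  qed
  then show "T \<in> {T. T \<subseteq> edges G \<and> grow (ends G) {r} (verts G) T}" using T T' by auto
qed

theorem corollary1p5:
  fixes G :: "('v, 'e) graph" and \<beta> :: real
  assumes "finite_graph G" and "connected_graph G"
    and "(\<exists>n::nat. \<beta> = real n / 2) \<or> \<beta> \<ge> (real (card (verts G)) - 2) / 2"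
  shows "completely_monotone (edges G) (\<lambda>x. spanning_tree_poly G x powr (- \<beta>))"
proof -
  let ?E = "edges G"
  have fin: "finite (verts G)" "finite ?E" using assms(1) by (auto simp: finite_graph_def)
  obtain r where r: "r \<in> verts G" using assms(2) by (auto simp: connected_graph_def)
  obtain vs where vs: "distinct vs" "set vs = verts G - {r}"
    using finite_distinct_list[of "verts G - {r}"] fin by auto
  \<comment> \<open>Deleting the root leaves p - 1 pivots, which turns the threshold (p - 2)/2 into
    \<open>(length vs - 1) / 2\<close>.\<close>
  have len: "card (verts G) = Suc (length vs)"
    using card_Suc_Diff1[OF fin(1) r] distinct_card[OF vs(1)] vs(2) by simp
  have "\<forall>e\<in>?E. \<exists>s t. ends G e = {s, t}"
    using assms(1) by (fastforce simp: finite_graph_def card_1_singleton_iff card_2_iff)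
  then obtain s t where st: "\<And>e. e \<in> ?E \<Longrightarrow> ends G e = {s e, t e}" by metis
  have stV: "s e \<in> verts G \<and> t e \<in> verts G" if "e \<in> ?E" for e
    using st[OF that] that assms(1) by (fastforce simp: finite_graph_def)
  \<comment> \<open>Signed incidence vectors for an arbitrary orientation. A loop has the zero
    vector, in accordance with its absence from all trees.\<close>
  define a :: "'e \<Rightarrow> 'v \<Rightarrow> real" where "a = (\<lambda>e i. of_bool (i = s e) - of_bool (i = t e))"
  \<comment> \<open>The chosen ends describe \<open>ends G\<close> only on the edges of
    \<open>G\<close>.\<close>
  have grow_cong: "grow (ends G) {r} W T \<longleftrightarrow> grow (\<lambda>e. {s e, t e}) {r} W T" if "T \<subseteq> ?E" for W T
  proof -
    have "grow g R W T" if "grow f R W T" "T \<subseteq> ?E" "\<And>e. e \<in> ?E \<Longrightarrow> f e = g e"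
      for f g :: "'e \<Rightarrow> 'v set" and R W T
      using that by (induction rule: grow.induct) (auto intro: grow.intros)
    from this[of "ends G" "{r}" W T "\<lambda>e. {s e, t e}"] this[of "\<lambda>e. {s e, t e}" "{r}" W T "ends G"]
    show ?thesis using st that by auto
  qed
  have poly: "spanning_tree_poly G x = grow_poly (\<lambda>e. {s e, t e}) (verts G) {r} ?E x" for x
    unfolding spanning_tree_poly_def grow_poly_def spanning_trees_eq_grow[OF assms(1) r]
    using grow_cong by (intro sum.cong) auto
  have dd: "diag_dominant (set vs) (gram ?E a x)"
    and det: "pivot_prod vs (gram ?E a x) = spanning_tree_poly G x" if "x \<in> pos_orthant ?E" for x
    using pivot_prod_laplacian[where x = x, OF fin(2) _ vs stV] r that
    unfolding poly a_def by (auto simp: pos_orthant_def PiE_iff less_imp_le)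
  have trees: "finite (spanning_trees G)"
    by (rule finite_subset[of _ "Pow ?E"]) (use fin in \<open>auto simp: spanning_trees_def\<close>)
  have sub: "T \<subseteq> ?E" if "T \<in> spanning_trees G" for T using that by (simp add: spanning_trees_def)
  have pos: "0 < spanning_tree_poly G x" if x: "x \<in> pos_orthant ?E" for x
    unfolding spanning_tree_poly_def
  proof (rule sum_pos[OF trees])
    \<comment> \<open>Connectedness enters here: some spanning tree exists, and every monomial is
      positive on the orthant.\<close>
    show "spanning_trees G \<noteq> {}"
      using connected_grow[OF assms(1,2) r] spanning_trees_eq_grow[OF assms(1) r] by auto
    show "0 < (\<Prod>e\<in>T. x e)" if "T \<in> spanning_trees G" for T
      using sub[OF that] x by (intro prod_pos) (auto simp: pos_orthant_def PiE_iff)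
  qed
  show ?thesis
  proof (rule completely_monotoneI)
    have "(\<lambda>x. spanning_tree_poly G x) \<in> smooth_fns ?E"
      unfolding spanning_tree_poly_def
      using sub by (intro smooth_fns_sum smooth_fns_prod smooth_fns.proj) auto
    then show "(\<lambda>x. spanning_tree_poly G x powr (- \<beta>)) \<in> smooth_fns ?E"
      using pos by (intro smooth_fns.powr) auto
    have "alternating ?E (\<lambda>x. pivot_prod vs (gram ?E a x) powr (- \<beta>))"
    proof (rule alternating_pivot_prod_powr[OF vs(1) dd])
      show "(\<exists>n::nat. \<beta> = real n / 2) \<or> (real (length vs) - 1) / 2 \<le> \<beta>"
        using assms(3) by (simp add: len)
    qed (simp_all add: det pos)
    then show "alternating ?E (\<lambda>x. spanning_tree_poly G x powr (- \<beta>))"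
      by (rule alternating_cong) (simp add: det)
  qed
qed

end
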